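(* Let $k$ be a field of arbitrary characteristic, let $R$ be a $k$-domain, let $n\ge 2$, let $B=R^{[n]}$ be the polynomial ring in $n$ variables over $R$, and let $\delta\in\mathrm{EXP}_R(B)$ be a triangular exponential map. Then $B^{\delta}$ is non-rigid.
   Context: A $k$-domain is an integral domain containing the field $k$. For domains $k\subset R\subset B$, an $R$-exponential map $\delta\in \mathrm{EXP}_R(B)$ is a family $\{D_n\}_{n\ge 0}$ of $R$-linear endomorphisms of $B$ such that: (1) $D_0=\mathrm{id}$; (2) for every $b\in B$ there is $n>0$ with $D_i(b)=0$ for all $i\ge n$; (3) $D_n(xy)=\sum_{i=0}^n D_i(x)D_{n-i}(y)$ for all $x,y\in B$, $n\ge 0$; (4) $D_j\circ D_i=\binom{i+j}{j}D_{i+j}$ for all $i,j\ge 0$. One also views $\delta$ as the $R$-algebra homomorphism $\delta:B\to B[t]$, $\delta(b)=\sum_n D_n(b)t^n$. The ring of invariants is $B^\delta=\{b\in B:\delta(b)=b\}$; $\delta$ is non-trivial if $B^\delta\ne B$. $\mathrm{EXP}(B)=\mathrm{EXP}_k(B)$. A local slice of $\delta$ is an element $x\in B$ such that $\deg_t\delta(x)$ is positive and minimal among the positive $t$-degrees of elements $\delta(b)$, $b\in B$. For $B=R^{[n]}$, $\delta\in\mathrm{EXP}_R(B)$ is triangular (over $R$) if there is a coordinate system $\{X_1,\dots,X_n\}$ of $B$ over $R$ (that is, $B=R[X_1,\dots,X_n]$) such that (a) $\delta(X_i)-X_i\in tR[X_1,\dots,X_{i-1}][t]$ for all $1\le i\le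 n$; and (b) if $i$ is the smallest integer with $\delta(X_i)\ne X_i$, then $X_i$ is a local slice of $\delta$. A $k$-domain is rigid if it has no non-trivial exponential map (in $\mathrm{EXP}=\mathrm{EXP}_k$), and non-rigid otherwise. *)

theory Defs
  imports "HOL-Computational_Algebra.Polynomial" "HOL-Library.Poly_Mapping"
begin

text \<open>
  All rings of the development are subrings of one ambient integral domain, the type
  \<open>'b\<close> of class \<open>idom\<close>; the polynomial ring $B$ is all of \<open>'b\<close>, and $k \subseteq R \subseteq B$
  and $B^\delta$ are subsets of it.
\<close>

definition is_subring :: "'b::comm_ring_1 set \<Rightarrow> bool" where
  "is_subring A \<longleftrightarrow> 0 \<in> A \<and> 1 \<in> A \<and> (\<forall>x\<in>A. \<forall>y\<in>A. x + y \<in> A \<and> x * y \<in> A) \<and> (\<forall>x\<in>A. - x \<in> A)"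

definition is_subfield :: "'b::comm_ring_1 set \<Rightarrow> bool" where
  "is_subfield k \<longleftrightarrow> is_subring k \<and> (0::'b) \<noteq> 1 \<and> (\<forall>x\<in>k. x \<noteq> 0 \<longrightarrow> (\<exists>y\<in>k. x * y = 1))"

definition k_domain :: "'b::idom set \<Rightarrow> 'b set \<Rightarrow> bool" where
  "k_domain k A \<longleftrightarrow> is_subfield k \<and> is_subring A \<and> k \<subseteq> A"


text \<open>
  \<open>EXP S A\<close> is the set of $S$-exponential maps on $A$, given by their families $(D_n)$.
  The functions \<open>D n\<close> are total on \<open>'b\<close>; only their values on \<open>A\<close> matter.
\<close>

definition EXP :: "'b::idom set \<Rightarrow> 'b set \<Rightarrow> (nat \<Rightarrow> 'b \<Rightarrow> 'b) set" where
  "EXP S A = {D.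
     (\<forall>n. D n ` A \<subseteq> A) \<and>
     (\<forall>n. \<forall>x\<in>A. \<forall>y\<in>A. D n (x + y) = D n x + D n y) \<and>
     (\<forall>n. \<forall>s\<in>S. \<forall>x\<in>A. D n (s * x) = s * D n x) \<and>
     (\<forall>x\<in>A. D 0 x = x) \<and>
     (\<forall>x\<in>A. \<exists>n>0. \<forall>i\<ge>n. D i x = 0) \<and>
     (\<forall>n. \<forall>x\<in>A. \<forall>y\<in>A. D n (x * y) = (\<Sum>i=0..n. D i x * D (n - i) y)) \<and>
     (\<forall>i j. \<forall>x\<in>A. D j (D i x) = of_nat ((i + j) choose j) * D (i + j) x)}"

text \<open>The associated map $\delta(b) = \sum_n D_n(b)\, t^n$ into polynomials in $t$.\<close>

definition exp_hom :: "(nat \<Rightarrow> 'b::idom \<Rightarrow> 'b) \<Rightarrow> 'b \<Rightarrow> 'b poly" where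
  "exp_hom D b = (\<Sum>n | D n b \<noteq> 0. monom (D n b) n)"

lemma coeff_exp_hom:
  assumes "D \<in> EXP S A" "b \<in> A"
  shows "coeff (exp_hom D b) n = D n b"
proof -
  from assms obtain N where N: "\<forall>i\<ge>N. D i b = 0"
    by (auto simp: EXP_def)
  have "{n. D n b \<noteq> 0} \<subseteq> {..<N}"
    using N by (metis (mono_tags, lifting) lessThan_iff mem_Collect_eq not_le subsetI)
  then have "finite {n. D n b \<noteq> 0}"
    using finite_subset by blast
  then show ?thesis
    by (simp add: exp_hom_def coeff_sum)
qed

definition invariants :: "'b::idom set \<Rightarrow> (nat \<Rightarrow> 'b \<Rightarrow> 'b) \<Rightarrow> 'b set" where
  "invariants A D = {b \<in> A. exp_hom D b = [:b:]}"

definition nontrivial :: "'b::idom set \<Rightarrow> (nat \<Rightarrow> 'b \<Rightarrow> 'b) \<Rightarrow> bool" where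
  "nontrivial A D \<longleftrightarrow> invariants A D \<noteq> A"

definition rigid :: "'b::idom set \<Rightarrow> 'b set \<Rightarrow> bool" where
  "rigid k A \<longleftrightarrow> \<not> (\<exists>D \<in> EXP k A. nontrivial A D)"

definition local_slice :: "'b::idom set \<Rightarrow> (nat \<Rightarrow> 'b \<Rightarrow> 'b) \<Rightarrow> 'b \<Rightarrow> bool" where
  "local_slice A D x \<longleftrightarrow> x \<in> A \<and> 0 < degree (exp_hom D x) \<and>
     (\<forall>b\<in>A. 0 < degree (exp_hom D b) \<longrightarrow> degree (exp_hom D x) \<le> degree (exp_hom D b))"


text \<open>
  \<open>mpolys R n\<close> is the set of formal polynomials with coefficients in \<open>R\<close> in the variables
  $T_1, \dots, T_n$: a finitely supported function from exponent vectors to coefficients,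
  where an exponent vector is a finitely supported function on variable indices.
\<close>

definition mpolys :: "'b::idom set \<Rightarrow> nat \<Rightarrow> ((nat \<Rightarrow>\<^sub>0 nat) \<Rightarrow>\<^sub>0 'b) set" where
  "mpolys R n = {p. (\<forall>m. Poly_Mapping.lookup p m \<in> R) \<and>
                    (\<forall>m\<in>Poly_Mapping.keys p. Poly_Mapping.keys m \<subseteq> {1..n})}"

definition eval_mpoly :: "(nat \<Rightarrow> 'b::idom) \<Rightarrow> ((nat \<Rightarrow>\<^sub>0 nat) \<Rightarrow>\<^sub>0 'b) \<Rightarrow> 'b" where
  "eval_mpoly X p = (\<Sum>m\<in>Poly_Mapping.keys p.
     Poly_Mapping.lookup p m * (\<Prod>i\<in>Poly_Mapping.keys m. X i ^ Poly_Mapping.lookup m i))"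

text \<open>The subalgebra $R[X_1, \dots, X_m]$; it is $R$ itself for $m = 0$.\<close>

definition subalgebra :: "'b::idom set \<Rightarrow> (nat \<Rightarrow> 'b) \<Rightarrow> nat \<Rightarrow> 'b set" where
  "subalgebra R X m = eval_mpoly X ` mpolys R m"

text \<open>
  $\{X_1, \dots, X_n\}$ is a coordinate system of $B$ over $R$ if substituting $X_i$ for $T_i$
  identifies $R[T_1, \dots, T_n]$ with $B$; only the values of \<open>X\<close> at $1, \dots, n$ matter.
\<close>

definition coordinate_system :: "'b::idom set \<Rightarrow> 'b set \<Rightarrow> nat \<Rightarrow> (nat \<Rightarrow> 'b) \<Rightarrow> bool" where
  "coordinate_system R B n X \<longleftrightarrow> bij_betw (eval_mpoly X) (mpolys R n) B"

definition is_polynomial_ring :: "'b::idom set \<Rightarrow> 'b set \<Rightarrow> nat \<Rightarrow> bool" where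
  "is_polynomial_ring R B n \<longleftrightarrow> (\<exists>X. coordinate_system R B n X)"

text \<open>
  In the first condition, \<open>pCons 0 q\<close> is $t\,q$. The second condition is vacuous if all
  $X_i$ are invariant, that is, the trivial exponential map is triangular.
\<close>

definition triangular :: "'b::idom set \<Rightarrow> 'b set \<Rightarrow> nat \<Rightarrow> (nat \<Rightarrow> 'b \<Rightarrow> 'b) \<Rightarrow> bool" where
  "triangular R B n D \<longleftrightarrow> (\<exists>X. coordinate_system R B n X \<and>
     (\<forall>i\<in>{1..n}. \<exists>q. (\<forall>j. coeff q j \<in> subalgebra R X (i - 1)) \<and>
                     exp_hom D (X i) - [:X i:] = pCons 0 q) \<and>
     (\<forall>i\<in>{1..n}. exp_hom D (X i) \<noteq> [:X i:] \<and> (\<forall>j\<in>{1..<i}. exp_hom D (X j) = [:X j:])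
                  \<longrightarrow> local_slice B D (X i)))"

end

theory Submission
  imports Defs
begin

text \<open>
  Write $A = R[X_1, \dots, X_{n-1}]$ and $y = X_n$, so that $B = A[y]$.  The shift $y \mapsto y + u$
  over $A$ is an exponential map of $B$ whose components are the Hasse derivatives in $y$.  By
  triangularity $\delta$ preserves $A$, and $\delta(y) - y$ has coefficients in $A$; hence the shift
  commutes with $\delta$ (\<open>shift_map_commutes\<close>) and restricts to $B^\delta$.  It moves every
  element outside $A$ (\<open>shift_map_moves\<close>), so $B^\delta$ is non-rigid as soon as
  $B^\delta \not\subseteq A$.

  Suppose then that $B^\delta \subseteq A$.  If one of $X_1, \dots, X_{n-1}$ were moved, the first moved
  one would be a local slice $x \in A$.  The slice theorem embeds $B$ into $B^\delta[x]$ up to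
  denominators from $B^\delta$, and $B^\delta[x] \subseteq A$, so $y$ would be a quotient of elements
  of $A$ (\<open>local_slice_clear_denominators\<close>), which is absurd since $y$ is transcendental over $A$.
  Therefore $X_1, \dots, X_{n-1}$ are invariant, $B^\delta = A$, and as $n \ge 2$ the shift of $X_{n-1}$
  over $R[X_1, \dots, X_{n-2}]$ is a non-trivial exponential map of $B^\delta$.
\<close>

section \<open>Subrings and evaluation of univariate polynomials\<close>

lemma is_subringD:
  assumes "is_subring A"
  shows "0 \<in> A" "1 \<in> A" "x \<in> A \<Longrightarrow> y \<in> A \<Longrightarrow> x + y \<in> A"
    "x \<in> A \<Longrightarrow> y \<in> A \<Longrightarrow> x * y \<in> A" "x \<in> A \<Longrightarrow> - x \<in> A"
    "x \<in> A \<Longrightarrow> y \<in> A \<Longrightarrow> x - y \<in> A"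
  using assms unfolding is_subring_def by (auto simp: diff_conv_add_uminus simp del: add_uminus_conv_diff)

lemma subring_sum:
  assumes "is_subring A" "\<And>i. i \<in> I \<Longrightarrow> f i \<in> A"
  shows "sum f I \<in> A"
  using assms(2) by (induction I rule: infinite_finite_induct) (auto intro: is_subringD[OF assms(1)])

lemma subring_prod:
  assumes "is_subring A" "\<And>i. i \<in> I \<Longrightarrow> f i \<in> A"
  shows "prod f I \<in> A"
  using assms(2) by (induction I rule: infinite_finite_induct) (auto intro: is_subringD[OF assms(1)])

lemma subring_power:
  assumes "is_subring A" "x \<in> A"
  shows "x ^ n \<in> A"
  by (induction n) (auto intro: is_subringD[OF assms(1)] assms(2))

lemma subring_of_nat:
  assumes "is_subring A"
  shows "of_nat n \<in> A"
  by (induction n) (auto intro: is_subringD[OF assms])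

definition polys_over :: "'b::comm_ring_1 set \<Rightarrow> 'b poly set" where
  "polys_over A = {p. \<forall>i. coeff p i \<in> A}"

lemma polys_over_subring:
  assumes "is_subring A"
  shows "is_subring (polys_over A)"
  unfolding is_subring_def polys_over_def
  by (auto simp: coeff_mult coeff_1 intro!: subring_sum assms is_subringD[OF assms])

lemma polys_over_pCons:
  assumes "is_subring A" "a \<in> A" "p \<in> polys_over A"
  shows "pCons a p \<in> polys_over A"
  using assms unfolding polys_over_def by (auto simp: coeff_pCons split: nat.split)

lemma polys_over_const:
  assumes "is_subring A" "a \<in> A"
  shows "[:a:] \<in> polys_over A"
  using assms by (intro polys_over_pCons) (auto intro: is_subringD polys_over_subring)

lemma adjoin_subring:
  fixes y :: "'b::comm_ring_1"
  assumes "is_subring A"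
  shows "is_subring ((\<lambda>p. poly p y) ` polys_over A)"
proof -
  note P = is_subringD[OF polys_over_subring[OF assms]]
  show ?thesis
    unfolding is_subring_def
  proof (intro conjI ballI)
    show "0 \<in> (\<lambda>p. poly p y) ` polys_over A"
      by (rule image_eqI[where x = 0]) (auto intro: P)
    show "1 \<in> (\<lambda>p. poly p y) ` polys_over A"
      by (rule image_eqI[where x = 1]) (auto intro: P)
  next
    fix u v assume "u \<in> (\<lambda>p. poly p y) ` polys_over A" "v \<in> (\<lambda>p. poly p y) ` polys_over A"
    then obtain p q where "u = poly p y" "v = poly q y" "p \<in> polys_over A" "q \<in> polys_over A"
      by auto
    then show "u + v \<in> (\<lambda>p. poly p y) ` polys_over A" "u * v \<in> (\<lambda>p. poly p y) ` polys_over A"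
      using P(3,4)[of p q] by (metis image_eqI poly_add, metis image_eqI poly_mult)
  next
    fix u assume "u \<in> (\<lambda>p. poly p y) ` polys_over A"
    then obtain p where "u = poly p y" "p \<in> polys_over A" by auto
    then show "- u \<in> (\<lambda>p. poly p y) ` polys_over A"
      by (auto intro!: image_eqI[where x = "- p"] P)
  qed
qed

definition univariate_over :: "'b::comm_ring_1 set \<Rightarrow> 'b \<Rightarrow> 'b set \<Rightarrow> bool" where
  "univariate_over A y C \<longleftrightarrow>
     is_subring A \<and> bij_betw (\<lambda>p. poly p y) (polys_over A) C"

lemma univariate_overD:
  assumes "univariate_over A y C"
  shows "is_subring A" "is_subring C" "A \<subseteq> C" "y \<in> C"
    "p \<in> polys_over A \<Longrightarrow> poly p y \<in> C"
    "c \<in> C \<Longrightarrow> \<exists>p\<in>polys_over A. c = poly p y"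
    "p \<in> polys_over A \<Longrightarrow> q \<in> polys_over A \<Longrightarrow> poly p y = poly q y \<Longrightarrow> p = q"
proof -
  show A: "is_subring A" using assms by (simp add: univariate_over_def)
  have C: "C = (\<lambda>p. poly p y) ` polys_over A"
    using assms by (auto simp: univariate_over_def bij_betw_def)
  show "is_subring C" unfolding C by (rule adjoin_subring[OF A])
  show mem: "p \<in> polys_over A \<Longrightarrow> poly p y \<in> C" for p by (auto simp: C)
  show "A \<subseteq> C"
    using mem[OF polys_over_const[OF A]] by auto
  show "y \<in> C"
    using mem[of "[:0, 1:]"] by (auto intro: polys_over_pCons polys_over_const A is_subringD[OF A])
  show "c \<in> C \<Longrightarrow> \<exists>p\<in>polys_over A. c = poly p y" by (auto simp: C)
  show "p \<in> polys_over A \<Longrightarrow> q \<in> polys_over A \<Longrightarrow> poly p y = poly q y \<Longrightarrow> p = q"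
    using assms by (auto simp: univariate_over_def bij_betw_def dest: inj_onD)
qed

section \<open>Hasse derivatives\<close>

text \<open>The coefficient of $t^m$ in $p(y + t)$, which is $p^{(m)}/m!$ where $m!$ is invertible.\<close>

definition hasse :: "nat \<Rightarrow> 'b::comm_ring_1 poly \<Rightarrow> 'b poly" where
  "hasse m p = Abs_poly (\<lambda>i. of_nat ((i + m) choose m) * coeff p (i + m))"

lemma coeff_hasse: "coeff (hasse m p) i = of_nat ((i + m) choose m) * coeff p (i + m)"
proof -
  have "\<forall>\<^sub>\<infinity>i. of_nat ((i + m) choose m) * coeff p (i + m) = 0"
    unfolding MOST_nat by (intro exI[of _ "degree p"]) (auto simp: coeff_eq_0)
  then show ?thesis by (simp add: hasse_def Abs_poly_inverse)
qed

lemma hasse_add: "hasse m (p + q) = hasse m p + hasse m q"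
  by (rule poly_eqI) (simp add: coeff_hasse algebra_simps)

lemma hasse_sum: "hasse m (sum f I) = (\<Sum>i\<in>I. hasse m (f i))"
  by (rule poly_eqI) (simp add: coeff_hasse coeff_sum sum_distrib_left)

lemma hasse_smult: "hasse m (smult a p) = smult a (hasse m p)"
  by (rule poly_eqI) (simp add: coeff_hasse algebra_simps)

lemma hasse_0: "hasse 0 p = p"
  by (rule poly_eqI) (simp add: coeff_hasse)

lemma hasse_above_degree: "degree p < m \<Longrightarrow> hasse m p = 0"
  by (rule poly_eqI) (simp add: coeff_hasse coeff_eq_0)

lemma hasse_polys_over:
  assumes "is_subring A" "p \<in> polys_over A"
  shows "hasse m p \<in> polys_over A"
  using assms by (auto simp: polys_over_def coeff_hasse intro: is_subringD subring_of_nat)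

lemma hasse_hasse: "hasse j (hasse i p) = of_nat ((i + j) choose j) * hasse (i + j) p"
proof (rule poly_eqI)
  fix l
  have "(l + j choose j) * (l + j + i choose i) = (i + j choose j) * (l + (i + j) choose (i + j))"
  proof -
    have "(l + i + j choose (i + j)) * (i + j choose i) = (l + i + j choose i) * (l + j choose j)"
      using choose_mult[of i "i + j" "l + i + j"] by (simp add: algebra_simps)
    moreover have "(i + j choose i) = (i + j choose j)"
      using binomial_symmetric[of i "i + j"] by simp
    ultimately show ?thesis by (simp add: algebra_simps)
  qed
  then have "(of_nat (l + j choose j) * of_nat (l + j + i choose i) :: 'a)
    = of_nat (i + j choose j) * of_nat (l + (i + j) choose (i + j))"
    by (metis of_nat_mult)
  then show "coeff (hasse j (hasse i p)) l = coeff (of_nat ((i + j) choose j) * hasse (i + j) p) l"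
    by (simp add: coeff_hasse of_nat_poly mult.assoc[symmetric] add_ac)
qed

lemma hasse_monom: "hasse m (monom a i) = monom (of_nat (i choose m) * a) (i - m)"
  by (rule poly_eqI) (auto simp: coeff_hasse binomial_eq_0)

text \<open>Both sides are biadditive, and on monomials the rule is Vandermonde's identity.\<close>

lemma hasse_mult: "hasse m (p * q) = (\<Sum>s=0..m. hasse s p * hasse (m - s) q)"
proof -
  have mono: "hasse m (monom a i * monom b j) = (\<Sum>s=0..m. hasse s (monom a i) * hasse (m - s) (monom b j))"
    for a b :: 'a and i j
  proof -
    have "(\<Sum>s=0..m. hasse s (monom a i) * hasse (m - s) (monom b j))
      = (\<Sum>s=0..m. monom (of_nat ((i choose s) * (j choose (m - s))) * (a * b)) (i + j - m))"
    proof (rule sum.cong[OF refl])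
      fix s assume "s \<in> {0..m}"
      show "hasse s (monom a i) * hasse (m - s) (monom b j)
        = monom (of_nat ((i choose s) * (j choose (m - s))) * (a * b)) (i + j - m)"
      proof (cases "s \<le> i \<and> m - s \<le> j")
        case True
        then have "i - s + (j - (m - s)) = i + j - m" using \<open>s \<in> _\<close> by auto
        then show ?thesis by (simp add: hasse_monom mult_monom algebra_simps)
      next
        case False
        then show ?thesis by (auto simp: hasse_monom binomial_eq_0)
      qed
    qed
    also have "\<dots> = monom (of_nat (\<Sum>s=0..m. (i choose s) * (j choose (m - s))) * (a * b)) (i + j - m)"
      by (simp add: monom_sum sum_distrib_right)
    also have "(\<Sum>s=0..m. (i choose s) * (j choose (m - s))) = (i + j choose m)"
      using vandermonde[of i j m] by (simp add: atMost_atLeast0)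
    finally show ?thesis by (simp add: mult_monom hasse_monom)
  qed
  have p: "p = (\<Sum>i\<le>degree p. monom (coeff p i) i)" and q: "q = (\<Sum>i\<le>degree q. monom (coeff q i) i)"
    by (simp_all add: poly_as_sum_of_monoms)
  have "hasse m (p * q) = (\<Sum>i\<le>degree p. \<Sum>j\<le>degree q. \<Sum>s=0..m.
      hasse s (monom (coeff p i) i) * hasse (m - s) (monom (coeff q j) j))"
    by (subst p, subst q) (simp only: sum_product hasse_sum mono)
  also have "\<dots> = (\<Sum>s=0..m. \<Sum>i\<le>degree p. \<Sum>j\<le>degree q.
      hasse s (monom (coeff p i) i) * hasse (m - s) (monom (coeff q j) j))"
    by (simp only: sum.swap[of _ "{0..m}"])
  also have "\<dots> = (\<Sum>s=0..m. hasse s (\<Sum>i\<le>degree p. monom (coeff p i) i) *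
      hasse (m - s) (\<Sum>j\<le>degree q. monom (coeff q j) j))"
    by (simp only: sum_product hasse_sum)
  finally show ?thesis
    by (simp add: poly_as_sum_of_monoms)
qed

text \<open>
  The exponential map $y \mapsto y + t$ of $A[y]$ over $A$.  When $y$ is transcendental over $A$,
  the choice operator returns the only polynomial that represents the element.
\<close>

definition shift_map :: "'b::idom set \<Rightarrow> 'b \<Rightarrow> nat \<Rightarrow> 'b \<Rightarrow> 'b" where
  "shift_map A y m c = poly (hasse m (SOME p. p \<in> polys_over A \<and> c = poly p y)) y"

lemma shift_map_poly:
  assumes "univariate_over A y C" "p \<in> polys_over A"
  shows "shift_map A y m (poly p y) = poly (hasse m p) y"
proof -
  have "(SOME q. q \<in> polys_over A \<and> poly p y = poly q y) = p"
    using assms univariate_overD(7)[OF assms(1)] by (intro some_equality) auto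
  then show ?thesis by (simp add: shift_map_def)
qed

lemma shift_map_EXP:
  assumes "univariate_over A y C"
  shows "shift_map A y \<in> EXP A C"
proof -
  note U = univariate_overD[OF assms]
  note P = is_subringD[OF polys_over_subring[OF U(1)]]
  note S = shift_map_poly[OF assms]
  note H = hasse_polys_over[OF U(1)]
  have prod: "shift_map A y m (poly p y * poly q y) =
      (\<Sum>i=0..m. shift_map A y i (poly p y) * shift_map A y (m - i) (poly q y))"
    if "p \<in> polys_over A" "q \<in> polys_over A" for m p q
    using S[OF P(4)[OF that]] that by (simp add: S hasse_mult poly_sum)
  show ?thesis
    unfolding EXP_def mem_Collect_eq
  proof (intro conjI allI ballI)
    fix m show "shift_map A y m ` C \<subseteq> C"
    proof
      fix z assume "z \<in> shift_map A y m ` C"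
      then obtain p where "p \<in> polys_over A" "z = shift_map A y m (poly p y)" using U(6) by blast
      then show "z \<in> C" by (simp add: S U(5) H)
    qed
  next
    fix m u v assume "u \<in> C" "v \<in> C"
    then obtain p q where pq: "p \<in> polys_over A" "q \<in> polys_over A" "u = poly p y" "v = poly q y"
      using U(6) by metis
    show "shift_map A y m (u + v) = shift_map A y m u + shift_map A y m v"
      using S[OF P(3)[OF pq(1,2)]] pq by (simp add: S hasse_add)
    show "shift_map A y m (u * v) = (\<Sum>i=0..m. shift_map A y i u * shift_map A y (m - i) v)"
      using prod pq by simp
  next
    fix m a u assume "a \<in> A" "u \<in> C"
    then obtain p where p: "p \<in> polys_over A" "u = poly p y" using U(6) by blast
    have "smult a p \<in> polys_over A"
      using p \<open>a \<in> A\<close> by (auto simp: polys_over_def intro: is_subringD[OF U(1)])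
    from S[OF this] show "shift_map A y m (a * u) = a * shift_map A y m u"
      using p by (simp add: S hasse_smult)
  next
    fix u assume "u \<in> C"
    then obtain p where p: "p \<in> polys_over A" "u = poly p y" using U(6) by blast
    show "shift_map A y 0 u = u" using p by (simp add: S hasse_0)
    show "\<exists>n>0. \<forall>i\<ge>n. shift_map A y i u = 0"
      by (intro exI[of _ "Suc (degree p)"]) (use p in \<open>auto simp: S hasse_above_degree\<close>)
    fix i j
    show "shift_map A y j (shift_map A y i u) = of_nat (i + j choose j) * shift_map A y (i + j) u"
      using p by (simp add: S H hasse_hasse)
  qed
qed

lemma shift_map_base:
  assumes "univariate_over A y C" "a \<in> A" "m > 0"
  shows "shift_map A y m a = 0"
  using shift_map_poly[OF assms(1) polys_over_const[of A a]] assms univariate_overD(1)[OF assms(1)]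
  by (simp add: hasse_above_degree)

lemma shift_map_variable:
  assumes "univariate_over A y C" "m > 0"
  shows "shift_map A y m y = (if m = 1 then 1 else 0)"
proof -
  have "[:0, 1:] \<in> polys_over A"
    using univariate_overD(1)[OF assms(1)]
    by (intro polys_over_pCons polys_over_const) (auto intro: is_subringD)
  from shift_map_poly[OF assms(1) this] have "shift_map A y m y = poly (hasse m (monom 1 1)) y"
    by (simp add: monom_altdef)
  then show ?thesis using assms(2) by (auto simp: hasse_monom poly_monom binomial_eq_0)
qed

text \<open>
  In every characteristic, the component whose index is the degree in $y$ picks out the leading
  coefficient.
\<close>

lemma shift_map_moves:
  assumes "univariate_over A y C" "c \<in> C" "c \<notin> A"
  shows "\<exists>m>0. shift_map A y m c \<noteq> 0"
proof -
  obtain p where p: "p \<in> polys_over A" "c = poly p y"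
    using univariate_overD(6)[OF assms(1,2)] by blast
  have "degree p > 0"
  proof (rule ccontr)
    assume "\<not> degree p > 0"
    then obtain a where a: "p = [:a:]" by (auto elim: degree_eq_zeroE)
    then have "coeff p 0 = c" using p by simp
    then show False using p(1) assms(3) by (auto simp: polys_over_def)
  qed
  have "hasse (degree p) p = [:lead_coeff p:]"
    by (rule poly_eqI) (auto simp: coeff_hasse coeff_pCons coeff_eq_0 split: nat.split)
  then have "shift_map A y (degree p) c = lead_coeff p"
    using p shift_map_poly[OF assms(1)] by simp
  moreover have "lead_coeff p \<noteq> 0" using \<open>degree p > 0\<close> by auto
  ultimately show ?thesis using \<open>degree p > 0\<close> by metis
qed

section \<open>Exponential maps\<close>

lemma EXP_D:
  assumes "D \<in> EXP S A"
  shows "x \<in> A \<Longrightarrow> D n x \<in> A"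
    "x \<in> A \<Longrightarrow> y \<in> A \<Longrightarrow> D n (x + y) = D n x + D n y"
    "s \<in> S \<Longrightarrow> x \<in> A \<Longrightarrow> D n (s * x) = s * D n x"
    "x \<in> A \<Longrightarrow> D 0 x = x"
    "x \<in> A \<Longrightarrow> y \<in> A \<Longrightarrow> D n (x * y) = (\<Sum>i=0..n. D i x * D (n - i) y)"
    "x \<in> A \<Longrightarrow> D j (D i x) = of_nat ((i + j) choose j) * D (i + j) x"
  using assms by (auto simp: EXP_def)

lemma EXP_restrict:
  assumes "D \<in> EXP S A" "S' \<subseteq> S" "A' \<subseteq> A" "\<And>n x. x \<in> A' \<Longrightarrow> D n x \<in> A'"
  shows "D \<in> EXP S' A'"
  using assms unfolding EXP_def by (auto simp: subset_iff image_subset_iff)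

lemma invariants_iff:
  assumes "D \<in> EXP S A"
  shows "b \<in> invariants A D \<longleftrightarrow> b \<in> A \<and> (\<forall>j>0. D j b = 0)"
proof -
  have "exp_hom D b = [:b:] \<longleftrightarrow> (\<forall>j>0. D j b = 0)" if "b \<in> A"
    using that EXP_D(4)[OF assms that]
    by (auto simp: poly_eq_iff coeff_exp_hom[OF assms that] coeff_pCons gr0_conv_Suc split: nat.split)
  then show ?thesis by (auto simp: invariants_def)
qed

lemma not_rigidI:
  assumes "D \<in> EXP k A" "b \<in> A" "m > 0" "D m b \<noteq> 0"
  shows "\<not> rigid k A"
  using assms invariants_iff[OF assms(1), of b] by (auto simp: rigid_def nontrivial_def)

context
  fixes D :: "nat \<Rightarrow> 'b::idom \<Rightarrow> 'b" and S :: "'b set"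
  assumes D: "D \<in> EXP S UNIV"
begin

lemmas coeff_exp_hom_UNIV = coeff_exp_hom[OF D UNIV_I]
lemmas D_rules = EXP_D[OF D, simplified]

lemma exp_hom_add: "exp_hom D (x + y) = exp_hom D x + exp_hom D y"
  by (rule poly_eqI) (simp add: coeff_exp_hom_UNIV D_rules)

lemma exp_hom_mult: "exp_hom D (x * y) = exp_hom D x * exp_hom D y"
  by (rule poly_eqI) (simp add: coeff_exp_hom_UNIV D_rules coeff_mult atMost_atLeast0)

lemma exp_hom_0: "exp_hom D 0 = 0"
  using exp_hom_add[of 0 0] by (metis add_0_left add_cancel_right_right)

lemma exp_hom_uminus: "exp_hom D (- x) = - exp_hom D x"
  using exp_hom_add[of x "- x"] by (simp add: exp_hom_0 eq_neg_iff_add_eq_0 add.commute)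

lemma exp_hom_diff: "exp_hom D (x - y) = exp_hom D x - exp_hom D y"
  using exp_hom_add[of x "- y"] by (simp add: exp_hom_uminus)

lemma exp_hom_1: "exp_hom D 1 = 1"
proof -
  have "coeff (exp_hom D 1) 0 = 1" by (simp add: coeff_exp_hom_UNIV D_rules)
  then have "exp_hom D 1 \<noteq> 0" by auto
  then show ?thesis using exp_hom_mult[of 1 1] by simp
qed

lemma exp_hom_power: "exp_hom D (x ^ n) = exp_hom D x ^ n"
  by (induction n) (simp_all add: exp_hom_1 exp_hom_mult)

lemma D_1: "j > 0 \<Longrightarrow> D j 1 = 0"
  using coeff_exp_hom_UNIV[of 1 j] by (simp add: exp_hom_1 coeff_1)

lemma D_0: "D j 0 = 0"
  using D_rules(2)[where x = 0 and y = 0 and n = j] by (metis add_0_left add_cancel_right_right)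

lemma D_constant: "s \<in> S \<Longrightarrow> j > 0 \<Longrightarrow> D j s = 0"
  using D_rules(3)[where s = s and x = 1 and n = j] by (simp add: D_1)

lemma D_sum: "D j (sum f I) = (\<Sum>i\<in>I. D j (f i))"
  by (induction I rule: infinite_finite_induct) (auto simp: D_0 D_rules)

lemma D_uminus: "D j (- x) = - D j x"
  using D_rules(2)[where x = x and y = "- x" and n = j] by (simp add: D_0 eq_neg_iff_add_eq_0 add.commute)

lemma invariant_iff: "b \<in> invariants UNIV D \<longleftrightarrow> exp_hom D b = [:b:]"
  by (simp add: invariants_def)

lemma invariants_subring: "is_subring (invariants UNIV D)"
  unfolding is_subring_def
  by (auto simp: invariant_iff exp_hom_0 exp_hom_add exp_hom_mult exp_hom_1 exp_hom_uminus one_pCons)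

lemma constants_invariant: "S \<subseteq> invariants UNIV D"
  using D_constant by (auto simp: invariants_iff[OF D])

section \<open>Local slices\<close>

text \<open>
  The coefficient of $t^{N-i}$ in $\delta(D_i(b))$ is $\binom{N}{i} D_N(b)$, so it is the leading one
  as soon as the binomial coefficient survives in the ring.
\<close>

lemma degree_D:
  fixes b :: 'b
  defines "N \<equiv> degree (exp_hom D b)"
  assumes "N > 0" "i \<le> N" "(of_nat (N choose i) :: 'b) \<noteq> 0"
  shows "degree (exp_hom D (D i b)) = N - i"
proof (rule antisym)
  have zero: "D j b = 0" if "j > N" for j
    using that coeff_exp_hom_UNIV[of b j] by (simp add: N_def coeff_eq_0)
  show "degree (exp_hom D (D i b)) \<le> N - i"
    by (rule degree_le) (auto simp: coeff_exp_hom_UNIV D_rules zero)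
  have "D N b \<noteq> 0"
    using assms(2) coeff_exp_hom_UNIV[of b N] leading_coeff_0_iff[of "exp_hom D b"]
    by (auto simp: N_def)
  moreover have "(i + (N - i) choose (N - i)) = (N choose i)"
    using assms(3) binomial_symmetric[of i N] by simp
  ultimately have "coeff (exp_hom D (D i b)) (N - i) \<noteq> 0"
    using assms(3,4) by (simp add: coeff_exp_hom_UNIV D_rules)
  then show "N - i \<le> degree (exp_hom D (D i b))" by (rule le_degree)
qed

lemma leading_coeff_invariant: "lead_coeff (exp_hom D b) \<in> invariants UNIV D"
proof -
  have "D j b = 0" if "j > degree (exp_hom D b)" for j
    using that coeff_exp_hom_UNIV[of b j] by (simp add: coeff_eq_0)
  then show ?thesis by (auto simp: invariants_iff[OF D] coeff_exp_hom_UNIV D_rules)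
qed

text \<open>
  A congruence of Lucas type.  When the inner binomial coefficients of row $d$ vanish, which makes
  $d$ behave like a power of the characteristic, Vandermonde's convolution retains only the two
  outer terms, and one of them is zero since $r < d$.
\<close>

lemma binomial_multiple_eq_1:
  assumes "\<And>i. 0 < i \<Longrightarrow> i < d \<Longrightarrow> (of_nat (d choose i) :: 'b) = 0" "r < d"
  shows "(of_nat ((q * d + r) choose (q * d)) :: 'b) = 1"
proof (induction q)
  case 0
  then show ?case by simp
next
  case (Suc q)
  let ?M = "q * d + r" and ?f = "\<lambda>i. of_nat (d choose i) * of_nat ((q * d + r) choose (Suc q * d - i)) :: 'b"
  have "(of_nat ((Suc q * d + r) choose (Suc q * d)) :: 'b) = (\<Sum>i\<le>Suc q * d. ?f i)"
    using arg_cong[OF vandermonde[of d ?M "Suc q * d"], of "of_nat :: nat \<Rightarrow> 'b"]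
    by (simp add: algebra_simps)
  also have "\<dots> = (\<Sum>i\<in>{d}. ?f i)"
  proof (rule sum.mono_neutral_right)
    show "\<forall>i\<in>{..Suc q * d} - {d}. ?f i = 0"
    proof
      fix i assume "i \<in> {..Suc q * d} - {d}"
      then consider "i = 0" | "0 < i" "i < d" | "i > d" by force
      then show "?f i = 0"
        using assms by cases (auto simp: binomial_eq_0)
    qed
  qed auto
  also have "\<dots> = 1" using Suc by simp
  finally show ?case .
qed

text \<open>
  If the degree $N$ of some element were not a multiple of the minimal degree $d$, a suitable
  component $D_i$ would take it to an element of degree $N \bmod d$, contradicting minimality.
  The binomial coefficient involved is a unit because minimality of $d$ already forces the inner
  binomial coefficients of row $d$ to vanish.
\<close>

lemma local_slice_degree_dvd:
  assumes "local_slice UNIV D x"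
  shows "degree (exp_hom D x) dvd degree (exp_hom D b)"
proof -
  define d where "d = degree (exp_hom D x)"
  define N where "N = degree (exp_hom D b)"
  have d: "d > 0" and min: "\<And>z. degree (exp_hom D z) > 0 \<Longrightarrow> d \<le> degree (exp_hom D z)"
    using assms by (auto simp: local_slice_def d_def)
  have row: "(of_nat (d choose i) :: 'b) = 0" if "0 < i" "i < d" for i
  proof (rule ccontr)
    assume "(of_nat (d choose i) :: 'b) \<noteq> 0"
    with that d have "degree (exp_hom D (D i x)) = d - i"
      using degree_D[of x i] by (simp add: d_def)
    then show False using min[of "D i x"] that by simp
  qed
  have "N mod d = 0"
  proof (rule ccontr)
    assume r: "N mod d \<noteq> 0"
    define i where "i = N div d * d"
    have N: "N = i + N mod d" by (simp add: i_def)
    have "(of_nat (N choose i) :: 'b) = 1"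
      using binomial_multiple_eq_1[OF row, of "N mod d" "N div d"] d by (simp add: i_def)
    then have "degree (exp_hom D (D i b)) = N - i"
      using degree_D[of b i] N r by (simp add: N_def)
    then have "degree (exp_hom D (D i b)) = N mod d" using N by simp
    then show False using min[of "D i b"] r d by (metis mod_less_divisor gr0I not_less)
  qed
  then show ?thesis by (simp add: d_def N_def mod_eq_0_iff_dvd)
qed

text \<open>
  The descent behind the slice theorem.  For $b$ of degree $qd$, with $g$ and $c$ the invariant
  leading coefficients of $\delta(b)$ and $\delta(x)$, the element $c^q b - g x^q$ has smaller
  degree.  Hence a power of $c$ multiplies $b$ into $B^\delta[x]$, which lies in $A$.
\<close>

lemma local_slice_clear_denominators:
  assumes A: "is_subring A" "invariants UNIV D \<subseteq> A" and x: "x \<in> A" "local_slice UNIV D x"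
  shows "\<exists>a\<in>A. a \<noteq> 0 \<and> a * b \<in> A"
proof (induction "degree (exp_hom D b)" arbitrary: b rule: less_induct)
  case less
  note A_ops = is_subringD[OF A(1)]
  define d where "d = degree (exp_hom D x)"
  define N where "N = degree (exp_hom D b)"
  define c where "c = coeff (exp_hom D x) d"
  define g where "g = coeff (exp_hom D b) N"
  have d: "d > 0" using x by (simp add: local_slice_def d_def)
  have inv: "c \<in> invariants UNIV D" "g \<in> invariants UNIV D"
    unfolding c_def g_def d_def N_def by (rule leading_coeff_invariant)+
  have c0: "c \<noteq> 0" using d by (auto simp: c_def d_def)
  show ?case
  proof (cases "N = 0")
    case True
    then have "lead_coeff (exp_hom D b) = b" by (simp add: N_def coeff_exp_hom_UNIV D_rules)
    then have "b \<in> A" using leading_coeff_invariant[of b] A by auto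
    then show ?thesis using A_ops(2) by (intro bexI[of _ 1]) auto
  next
    case False
    obtain q where q: "N = d * q" using local_slice_degree_dvd[OF x(2), of b] by (auto simp: d_def N_def)
    define b' where "b' = c ^ q * b - g * x ^ q"
    have hom: "exp_hom D b' = smult (c ^ q) (exp_hom D b) - smult g (exp_hom D x ^ q)"
      using inv by (simp add: b'_def invariant_iff exp_hom_diff exp_hom_mult exp_hom_power poly_const_pow)
    have deg: "degree (exp_hom D x ^ q) = N"
      using c0 by (subst degree_power_eq) (auto simp: c_def q d_def)
    have "coeff (exp_hom D x ^ q) N = c ^ q"
      using deg lead_coeff_power[of "exp_hom D x" q] by (simp add: c_def d_def)
    then have "coeff (exp_hom D b') N = 0" by (simp add: hom g_def)
    moreover have "degree (exp_hom D b') \<le> N"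
      unfolding hom using deg
      by (intro degree_diff_le order.trans[OF degree_smult_le]) (auto simp: N_def)
    ultimately have "degree (exp_hom D b') < N"
      using False by (metis degree_0 leading_coeff_0_iff le_neq_implies_less not_gr_zero)
    then obtain a where a: "a \<in> A" "a \<noteq> 0" "a * b' \<in> A"
      using less by (auto simp: N_def)
    have "(a * c ^ q) * b = a * b' + a * (g * x ^ q)" by (simp add: b'_def algebra_simps)
    also have "\<dots> \<in> A"
      using a x(1) inv(2) A by (intro A_ops(3) a(3) A_ops(4)[OF a(1)] A_ops(4)[of g] subring_power) auto
    finally have "(a * c ^ q) * b \<in> A" .
    moreover have "a * c ^ q \<in> A" using a inv A by (intro A_ops subring_power) auto
    ultimately show ?thesis using a c0 by (intro bexI[of _ "a * c ^ q"]) auto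
  qed
qed

section \<open>Commuting with a shift\<close>

text \<open>
  By the Leibniz rules the elements on which all components of two exponential maps commute form
  a subring.  It contains $A$, which \<open>D\<close> preserves and the shift fixes.  It contains $y$, because the
  higher components of \<open>D\<close> at $y$ lie in $A$ and those of the shift at $y$ are \<open>0\<close> or \<open>1\<close>.
\<close>

lemma shift_map_commutes:
  assumes U: "univariate_over A y UNIV"
    and A: "\<And>j a. a \<in> A \<Longrightarrow> D j a \<in> A" and y: "\<And>j. j > 0 \<Longrightarrow> D j y \<in> A"
  shows "D j (shift_map A y m b) = shift_map A y m (D j b)"
proof -
  let ?E = "shift_map A y"
  note E = EXP_D[OF shift_map_EXP[OF U], simplified]
  have E0: "?E m 0 = 0" for m using E(2)[of m 0 0] by (metis add_0_left add_cancel_right_right)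
  have Esum: "?E m (sum f I) = (\<Sum>i\<in>I. ?E m (f i))" for m and f :: "nat \<Rightarrow> 'b" and I
    by (induction I rule: infinite_finite_induct) (auto simp: E0 E(2))
  define Q where "Q = {b. \<forall>j m. D j (?E m b) = ?E m (D j b)}"
  have base: "A \<subseteq> Q"
  proof
    fix a assume a: "a \<in> A"
    have "D j (?E m a) = ?E m (D j a)" for j m
      using a A by (cases "m = 0") (auto simp: E D_0 shift_map_base[OF U])
    then show "a \<in> Q" by (simp add: Q_def)
  qed
  have var: "y \<in> Q"
  proof -
    have "D j (?E m y) = ?E m (D j y)" for j m
      by (cases "m = 0"; cases "j = 0")
        (auto simp: E D_rules D_0 D_1 shift_map_base[OF U y] shift_map_variable[OF U])
    then show ?thesis by (simp add: Q_def)
  qed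
  have add: "u + v \<in> Q" if "u \<in> Q" "v \<in> Q" for u v
    using that by (simp add: Q_def E D_rules)
  have mult: "u * v \<in> Q" if "u \<in> Q" "v \<in> Q" for u v
  proof -
    have "D j (?E m (u * v)) = ?E m (D j (u * v))" for j m
    proof -
      have "D j (?E m (u * v)) = (\<Sum>s=0..m. \<Sum>i=0..j. D i (?E s u) * D (j - i) (?E (m - s) v))"
        by (simp add: E(5) D_sum D_rules(5))
      also have "\<dots> = (\<Sum>i=0..j. \<Sum>s=0..m. ?E s (D i u) * ?E (m - s) (D (j - i) v))"
        using that by (subst sum.swap) (simp add: Q_def)
      also have "\<dots> = ?E m (D j (u * v))"
        by (simp add: E(5) Esum D_rules(5))
      finally show ?thesis .
    qed
    then show ?thesis by (simp add: Q_def)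
  qed
  have "poly p y \<in> Q" if "p \<in> polys_over A" for p
    using that
  proof (induction p)
    case 0
    then show ?case using base is_subringD(1)[OF univariate_overD(1)[OF U]] by auto
  next
    case (pCons a p)
    then have "a \<in> A" and "p \<in> polys_over A"
      unfolding polys_over_def mem_Collect_eq
      using coeff_pCons_0 coeff_pCons_Suc by metis+
    then show ?case using pCons.IH base var by (auto intro!: add mult)
  qed
  moreover obtain p where "p \<in> polys_over A" "b = poly p y"
    using univariate_overD(6)[OF U, of b] by auto
  ultimately show ?thesis by (auto simp: Q_def)
qed


lemma stable_subring:
  assumes "is_subring A"
  shows "is_subring {a \<in> A. \<forall>j. D j a \<in> A}"
  using is_subringD[OF assms] unfolding is_subring_def mem_Collect_eq
  by (auto simp: D_0 D_rules D_uminus intro!: subring_sum[OF assms])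
     (metis D_1 D_rules(4) not_gr_zero)

end

section \<open>Coordinate systems one variable at a time\<close>

definition power_product :: "(nat \<Rightarrow> 'b::idom) \<Rightarrow> (nat \<Rightarrow>\<^sub>0 nat) \<Rightarrow> 'b" where
  "power_product X m = (\<Prod>i\<in>Poly_Mapping.keys m. X i ^ Poly_Mapping.lookup m i)"

lemma power_product_superset:
  assumes "finite K" "Poly_Mapping.keys m \<subseteq> K"
  shows "power_product X m = (\<Prod>i\<in>K. X i ^ Poly_Mapping.lookup m i)"
  unfolding power_product_def using assms
  by (intro prod.mono_neutral_left) (auto simp: in_keys_iff)

lemma power_product_append:
  assumes "i \<notin> Poly_Mapping.keys m"
  shows "power_product X (m + Poly_Mapping.single i l) = power_product X m * X i ^ l"
proof -
  have "power_product X (m + Poly_Mapping.single i l) =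
      (\<Prod>j\<in>insert i (Poly_Mapping.keys m). X j ^ Poly_Mapping.lookup (m + Poly_Mapping.single i l) j)"
    using Poly_Mapping.keys_add[of m "Poly_Mapping.single i l"]
    by (intro power_product_superset) (auto split: if_splits)
  also have "\<dots> = X i ^ l * (\<Prod>j\<in>Poly_Mapping.keys m. X j ^ Poly_Mapping.lookup (m + Poly_Mapping.single i l) j)"
    using assms by (simp add: lookup_add in_keys_iff)
  also have "(\<Prod>j\<in>Poly_Mapping.keys m. X j ^ Poly_Mapping.lookup (m + Poly_Mapping.single i l) j) = power_product X m"
    unfolding power_product_def using assms
    by (intro prod.cong) (auto simp: lookup_add lookup_single when_def)
  finally show ?thesis by (simp add: mult.commute)
qed

lemma eval_mpoly_superset:
  assumes "finite K" "Poly_Mapping.keys p \<subseteq> K"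
  shows "eval_mpoly X p = (\<Sum>m\<in>K. Poly_Mapping.lookup p m * power_product X m)"
  unfolding eval_mpoly_def power_product_def using assms
  by (intro sum.mono_neutral_left) (auto simp: in_keys_iff)

lemma eval_mpoly_add: "eval_mpoly X (p + q) = eval_mpoly X p + eval_mpoly X q"
proof -
  let ?K = "Poly_Mapping.keys p \<union> Poly_Mapping.keys q"
  have K: "finite ?K" by simp
  show ?thesis
    using Poly_Mapping.keys_add[of p q]
    by (simp add: eval_mpoly_superset[OF K] lookup_add algebra_simps sum.distrib)
qed

lemma eval_mpoly_0: "eval_mpoly X 0 = 0"
  by (simp add: eval_mpoly_def)

lemma eval_mpoly_sum: "eval_mpoly X (sum f I) = (\<Sum>i\<in>I. eval_mpoly X (f i))"
  by (induction I rule: infinite_finite_induct) (auto simp: eval_mpoly_0 eval_mpoly_add)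

lemma eval_mpoly_single: "eval_mpoly X (Poly_Mapping.single m c) = c * power_product X m"
  by (subst eval_mpoly_superset[of "{m}"]) auto

text \<open>The polynomial $\sum_{l \le d} f_l T^l$ in the additional variable $T = T_v$.\<close>

definition assemble :: "nat \<Rightarrow> nat \<Rightarrow> (nat \<Rightarrow> (nat \<Rightarrow>\<^sub>0 nat) \<Rightarrow>\<^sub>0 'b::idom) \<Rightarrow> (nat \<Rightarrow>\<^sub>0 nat) \<Rightarrow>\<^sub>0 'b" where
  "assemble v d f = (\<Sum>l\<le>d. \<Sum>m\<in>Poly_Mapping.keys (f l).
     Poly_Mapping.single (m + Poly_Mapping.single v l) (Poly_Mapping.lookup (f l) m))"

lemma mpolys_keys: "p \<in> mpolys R n \<Longrightarrow> m \<in> Poly_Mapping.keys p \<Longrightarrow> Poly_Mapping.keys m \<subseteq> {1..n}"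
  by (auto simp: mpolys_def)

lemma mpolys_sum:
  assumes "is_subring R" "\<And>i. i \<in> I \<Longrightarrow> f i \<in> mpolys R n"
  shows "sum f I \<in> mpolys R n"
  using assms(2)
proof (induction I rule: infinite_finite_induct)
  case (insert i I)
  then have "f i \<in> mpolys R n" "sum f I \<in> mpolys R n" by auto
  then have "f i + sum f I \<in> mpolys R n"
    using Poly_Mapping.keys_add[of "f i" "sum f I"]
    by (fastforce simp: mpolys_def lookup_add intro: is_subringD[OF assms(1)])
  then show ?case using insert by simp
qed (auto simp: mpolys_def intro: is_subringD[OF assms(1)])

lemma assemble_mpolys:
  assumes R: "is_subring R" and f: "\<And>l. f l \<in> mpolys R m"
  shows "assemble (Suc m) d f \<in> mpolys R (Suc m)"
  unfolding assemble_def
proof (intro mpolys_sum[OF R])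
  fix l \<mu> assume mu: "\<mu> \<in> Poly_Mapping.keys (f l)"
  have "Poly_Mapping.keys (\<mu> + Poly_Mapping.single (Suc m) l) \<subseteq> {1..Suc m}"
    using mpolys_keys[OF f mu] Poly_Mapping.keys_add[of \<mu> "Poly_Mapping.single (Suc m) l"]
    by (fastforce split: if_splits)
  then show "Poly_Mapping.single (\<mu> + Poly_Mapping.single (Suc m) l) (Poly_Mapping.lookup (f l) \<mu>) \<in> mpolys R (Suc m)"
    using f[of l] is_subringD(1)[OF R]
    by (auto simp: mpolys_def lookup_single when_def split: if_splits)
qed

lemma eval_assemble:
  assumes "\<And>l. f l \<in> mpolys R m"
  shows "eval_mpoly X (assemble (Suc m) d f) = (\<Sum>l\<le>d. eval_mpoly X (f l) * X (Suc m) ^ l)"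
proof -
  have "power_product X (\<mu> + Poly_Mapping.single (Suc m) l) = power_product X \<mu> * X (Suc m) ^ l"
    if "\<mu> \<in> Poly_Mapping.keys (f l)" for \<mu> l
    using mpolys_keys[OF assms that] by (intro power_product_append) auto
  then show ?thesis
    by (simp add: assemble_def eval_mpoly_sum eval_mpoly_single eval_mpoly_superset[OF _ subset_refl]
        sum_distrib_right mult.assoc)
qed

text \<open>
  No two terms of the double sum share an exponent vector: the exponent of the new variable
  determines \<open>l\<close>, and removing it determines the rest.
\<close>

lemma lookup_assemble:
  assumes f: "\<And>l. f l \<in> mpolys R m" and "l \<le> d" and mu: "\<mu> \<in> Poly_Mapping.keys (f l)"
  shows "Poly_Mapping.lookup (assemble (Suc m) d f) (\<mu> + Poly_Mapping.single (Suc m) l) =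
    Poly_Mapping.lookup (f l) \<mu>"
proof -
  let ?s = "Poly_Mapping.single (Suc m)"
  have inj: "\<nu> + ?s i = \<mu> + ?s l \<longleftrightarrow> i = l \<and> \<nu> = \<mu>" if nu: "\<nu> \<in> Poly_Mapping.keys (f i)" for i \<nu>
  proof
    assume eq: "\<nu> + ?s i = \<mu> + ?s l"
    have "Suc m \<notin> Poly_Mapping.keys \<nu>" "Suc m \<notin> Poly_Mapping.keys \<mu>"
      using mpolys_keys[OF f nu] mpolys_keys[OF f mu] by auto
    then have "i = l"
      using arg_cong[OF eq, of "\<lambda>q. Poly_Mapping.lookup q (Suc m)"]
      by (simp add: lookup_add in_keys_iff)
    with eq show "i = l \<and> \<nu> = \<mu>" by simp
  qed simp
  have "Poly_Mapping.lookup (assemble (Suc m) d f) (\<mu> + ?s l) =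
      (\<Sum>i\<le>d. \<Sum>\<nu>\<in>Poly_Mapping.keys (f i). if i = l \<and> \<nu> = \<mu> then Poly_Mapping.lookup (f i) \<nu> else 0)"
    unfolding assemble_def lookup_sum
    by (intro sum.cong refl) (simp add: lookup_single when_def inj)
  also have "\<dots> = (\<Sum>i\<le>d. if i = l then Poly_Mapping.lookup (f l) \<mu> else 0)"
  proof (rule sum.cong[OF refl])
    fix i
    show "(\<Sum>\<nu>\<in>Poly_Mapping.keys (f i). if i = l \<and> \<nu> = \<mu> then Poly_Mapping.lookup (f i) \<nu> else 0) =
      (if i = l then Poly_Mapping.lookup (f l) \<mu> else 0)"
      using mu by (cases "i = l") (simp_all add: sum.delta)
  qed
  also have "\<dots> = Poly_Mapping.lookup (f l) \<mu>" using \<open>l \<le> d\<close> by simp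
  finally show ?thesis .
qed

lemma choose_coefficients:
  assumes "p \<in> polys_over (subalgebra R X m)"
  obtains f where "\<And>l. f l \<in> mpolys R m" "\<And>l. coeff p l = eval_mpoly X (f l)"
proof -
  have "\<forall>l. \<exists>f. f \<in> mpolys R m \<and> coeff p l = eval_mpoly X f"
    using assms by (auto simp: polys_over_def subalgebra_def)
  then obtain f where "\<forall>l. f l \<in> mpolys R m \<and> coeff p l = eval_mpoly X (f l)" by metis
  then show ?thesis by (intro that[of f]) blast+
qed

lemma mpolys_const: "is_subring R \<Longrightarrow> c \<in> R \<Longrightarrow> Poly_Mapping.single 0 c \<in> mpolys R n"
  by (auto simp: mpolys_def lookup_single when_def intro: is_subringD split: if_splits)

lemma subalgebra_base:
  assumes "is_subring R"
  shows "R \<subseteq> subalgebra R X m"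
proof
  fix c assume "c \<in> R"
  then show "c \<in> subalgebra R X m"
    unfolding subalgebra_def
    using mpolys_const[OF assms, of c m]
    by (intro image_eqI[where x = "Poly_Mapping.single 0 c"])
       (simp_all add: eval_mpoly_single power_product_def)
qed

lemma subalgebra_variable:
  assumes "is_subring R" "i \<in> {1..m}"
  shows "X i \<in> subalgebra R X m"
proof -
  have "Poly_Mapping.single (Poly_Mapping.single i 1) 1 \<in> mpolys R m"
    using assms by (auto simp: mpolys_def lookup_single when_def intro: is_subringD split: if_splits)
  then show ?thesis
    unfolding subalgebra_def
    by (rule image_eqI[rotated]) (simp add: eval_mpoly_single power_product_def)
qed

lemma subalgebra_least:
  assumes "is_subring C" "R \<subseteq> C" "\<And>i. i \<in> {1..m} \<Longrightarrow> X i \<in> C"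
  shows "subalgebra R X m \<subseteq> C"
proof
  fix c assume "c \<in> subalgebra R X m"
  then obtain p where p: "p \<in> mpolys R m" "c = eval_mpoly X p" by (auto simp: subalgebra_def)
  have "Poly_Mapping.lookup p \<mu> * (\<Prod>i\<in>Poly_Mapping.keys \<mu>. X i ^ Poly_Mapping.lookup \<mu> i) \<in> C"
    if "\<mu> \<in> Poly_Mapping.keys p" for \<mu>
    using p(1) mpolys_keys[OF p(1) that] assms
    by (intro is_subringD(4)[OF assms(1)] subring_prod subring_power) (auto simp: mpolys_def)
  then show "c \<in> C"
    unfolding p(2) eval_mpoly_def by (intro subring_sum[OF assms(1)])
qed

lemma subalgebra_0:
  assumes "is_subring R"
  shows "subalgebra R X 0 = R"
  using subalgebra_base[OF assms, of X 0] subalgebra_least[OF assms subset_refl, of 0 X] by auto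

lemma subalgebra_Suc_superset:
  assumes "is_subring R"
  shows "(\<lambda>p. poly p (X (Suc m))) ` polys_over (subalgebra R X m) \<subseteq> subalgebra R X (Suc m)"
proof (rule image_subsetI)
  fix p assume "p \<in> polys_over (subalgebra R X m)"
  then obtain f where f: "\<And>l. f l \<in> mpolys R m" "\<And>l. coeff p l = eval_mpoly X (f l)"
    by (metis choose_coefficients)
  have "poly p (X (Suc m)) = eval_mpoly X (assemble (Suc m) (degree p) f)"
    by (simp add: poly_altdef f(2) eval_assemble[where R = R, OF f(1)])
  then show "poly p (X (Suc m)) \<in> subalgebra R X (Suc m)"
    using assemble_mpolys[OF assms f(1)] by (auto simp: subalgebra_def)
qed

text \<open>
  The right-hand side is a subring because the coefficients form one; this recursion is how
  $R[X_1, \dots, X_m]$ is seen to be closed under products.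
\<close>

lemma subalgebra_Suc:
  assumes "is_subring R" "is_subring (subalgebra R X m)"
  shows "subalgebra R X (Suc m) = (\<lambda>p. poly p (X (Suc m))) ` polys_over (subalgebra R X m)"
proof (rule antisym[OF subalgebra_least subalgebra_Suc_superset[OF assms(1)]])
  let ?C = "(\<lambda>p. poly p (X (Suc m))) ` polys_over (subalgebra R X m)"
  show "is_subring ?C" by (rule adjoin_subring[OF assms(2)])
  have const: "a \<in> ?C" if "a \<in> subalgebra R X m" for a
    using polys_over_const[OF assms(2) that] by (intro image_eqI[where x = "[:a:]"]) auto
  then show "R \<subseteq> ?C" using subalgebra_base[OF assms(1)] by blast
  fix i assume i: "i \<in> {1..Suc m}"
  show "X i \<in> ?C"
  proof (cases "i = Suc m")
    case True
    have "[:0, 1:] \<in> polys_over (subalgebra R X m)"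
      using assms(2) by (intro polys_over_pCons polys_over_const) (auto intro: is_subringD)
    then show ?thesis using True by (intro image_eqI[where x = "[:0, 1:]"]) auto
  next
    case False
    then show ?thesis using i by (intro const subalgebra_variable[OF assms(1)]) auto
  qed
qed

lemma subalgebra_subring:
  assumes "is_subring R"
  shows "is_subring (subalgebra R X m)"
  by (induction m) (simp_all add: subalgebra_0 assms subalgebra_Suc adjoin_subring)

lemma subalgebra_mono:
  assumes "is_subring R" "m \<le> m'"
  shows "subalgebra R X m \<subseteq> subalgebra R X m'"
  using assms
  by (intro subalgebra_least subalgebra_subring subalgebra_base subalgebra_variable) auto

text \<open>
  A relation for $X_{m+1}$ over $R[X_1, \dots, X_m]$ lifts, after choosing preimages of its
  coefficients, to one formal polynomial over $R$ in the kernel of the evaluation; its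
  coefficients are those of the chosen preimages.
\<close>

lemma subalgebra_univariate:
  assumes R: "is_subring R" and inj: "inj_on (eval_mpoly X) (mpolys R (Suc m))"
  shows "univariate_over (subalgebra R X m) (X (Suc m)) (subalgebra R X (Suc m))"
proof -
  note A = subalgebra_subring[OF R, of X m]
  have zero: "p = 0" if p: "p \<in> polys_over (subalgebra R X m)" "poly p (X (Suc m)) = 0" for p
  proof (rule poly_eqI)
    fix l
    obtain f where f: "\<And>l. f l \<in> mpolys R m" "\<And>l. coeff p l = eval_mpoly X (f l)"
      using choose_coefficients[OF p(1)] by metis
    let ?P = "assemble (Suc m) (degree p) f"
    have "eval_mpoly X ?P = eval_mpoly X 0"
      using p(2) by (simp add: poly_altdef f(2) eval_assemble[where R = R, OF f(1)] eval_mpoly_0)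
    moreover have "0 \<in> mpolys R (Suc m)" by (simp add: mpolys_def is_subringD[OF R])
    ultimately have P: "?P = 0" using inj assemble_mpolys[OF R f(1)] by (auto dest: inj_onD)
    show "coeff p l = coeff 0 l"
    proof (cases "l \<le> degree p")
      case True
      have "Poly_Mapping.keys (f l) = {}"
        using lookup_assemble[where f = f, OF f(1) True] P by (fastforce simp: in_keys_iff)
      then show ?thesis by (simp add: f(2) eval_mpoly_def)
    qed (simp add: coeff_eq_0)
  qed
  have "inj_on (\<lambda>p. poly p (X (Suc m))) (polys_over (subalgebra R X m))"
  proof (rule inj_onI)
    fix p q assume "p \<in> polys_over (subalgebra R X m)" "q \<in> polys_over (subalgebra R X m)"
      "poly p (X (Suc m)) = poly q (X (Suc m))"
    then show "p = q"
      using zero[of "p - q"] is_subringD(6)[OF polys_over_subring[OF A]] by simp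
  qed
  then show ?thesis
    using A subalgebra_Suc[OF R A] by (simp add: univariate_over_def bij_betw_def)
qed

lemma mpolys_mono: "m \<le> n \<Longrightarrow> mpolys R m \<subseteq> mpolys R n"
  by (force simp: mpolys_def)

section \<open>Invariants of triangular exponential maps\<close>

text \<open>
  If $A$ contained both $B^\delta$ and a local slice, some non-zero $a \<in> A$ would satisfy $ay \<in> A$,
  and $aT - ay$ would be an algebraic relation for $y$ over $A$.
\<close>

lemma invariants_not_in_base:
  assumes D: "D \<in> EXP S UNIV" and U: "univariate_over A y UNIV"
    and x: "x \<in> A" "local_slice UNIV D x"
  shows "\<not> invariants UNIV D \<subseteq> A"
proof
  note A = univariate_overD(1)[OF U]
  assume "invariants UNIV D \<subseteq> A"
  then obtain a where a: "a \<in> A" "a \<noteq> 0" "a * y \<in> A"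
    using local_slice_clear_denominators[OF D A _ x, of y] by blast
  have "[:0, a:] \<in> polys_over A" "[:a * y:] \<in> polys_over A"
    using a A by (auto intro!: polys_over_pCons polys_over_const is_subringD)
  moreover have "poly [:0, a:] y = poly [:a * y:] y" by (simp add: mult.commute)
  ultimately have "[:0, a:] = [:a * y:]" by (rule univariate_overD(7)[OF U])
  then show False using a by simp
qed

theorem theorem5p3:
  fixes k R :: "'b::idom set" and n :: nat and D :: "nat \<Rightarrow> 'b \<Rightarrow> 'b"
  assumes "is_subfield k"
    and "k_domain k R"
    and "n \<ge> 2"
    and "is_polynomial_ring R (UNIV :: 'b set) n"
    and "D \<in> EXP R (UNIV :: 'b set)"
    and "triangular R (UNIV :: 'b set) n D"
  shows "\<not> rigid k (invariants (UNIV :: 'b set) D)"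
proof -
  note D = assms(5)
  have R: "is_subring R" and kR: "k \<subseteq> R" using assms(2) by (auto simp: k_domain_def)
  define m where "m = n - 2"
  have n: "n = Suc (Suc m)" using assms(3) by (simp add: m_def)
  obtain X where X: "coordinate_system R UNIV n X"
    and tri: "\<And>i. i \<in> {1..n} \<Longrightarrow> \<exists>q. (\<forall>j. coeff q j \<in> subalgebra R X (i - 1)) \<and>
        exp_hom D (X i) - [:X i:] = pCons 0 q"
    and slice: "\<And>i. i \<in> {1..n} \<Longrightarrow> exp_hom D (X i) \<noteq> [:X i:] \<Longrightarrow>
        \<forall>j\<in>{1..<i}. exp_hom D (X j) = [:X j:] \<Longrightarrow> local_slice UNIV D (X i)"
    using assms(6) unfolding triangular_def by blast
  define A where "A = subalgebra R X (Suc m)"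
  define B where "B = invariants UNIV D"
  have inj: "inj_on (eval_mpoly X) (mpolys R n)" and "subalgebra R X n = UNIV"
    using X by (auto simp: coordinate_system_def bij_betw_def subalgebra_def)
  then have U: "univariate_over A (X n) UNIV"
    using subalgebra_univariate[OF R, of X "Suc m"] by (simp add: n A_def)
  have U': "univariate_over (subalgebra R X m) (X (Suc m)) A"
    using subalgebra_univariate[OF R, of X m] inj_on_subset[OF inj mpolys_mono] by (simp add: n A_def)
  have RA: "R \<subseteq> A" unfolding A_def by (rule subalgebra_base[OF R])
  have DX: "D j (X i) \<in> subalgebra R X (i - 1)" if i: "i \<in> {1..n}" and "j > 0" for i j
  proof -
    obtain q where q: "\<forall>j. coeff q j \<in> subalgebra R X (i - 1)" "exp_hom D (X i) - [:X i:] = pCons 0 q"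
      using tri[OF i] by blast
    obtain j' where "j = Suc j'" using \<open>j > 0\<close> gr0_conv_Suc by blast
    then have "D j (X i) = coeff q j'"
      using arg_cong[OF q(2), of "\<lambda>p. coeff p j"] by (simp add: coeff_exp_hom[OF D])
    then show ?thesis using q(1) by simp
  qed
  have stable: "D j a \<in> A" if "a \<in> A" for j a
  proof -
    have "subalgebra R X (Suc m) \<subseteq> {a \<in> A. \<forall>j. D j a \<in> A}"
    proof (rule subalgebra_least[OF stable_subring[OF D]])
      show "is_subring A" unfolding A_def by (rule subalgebra_subring[OF R])
      show "R \<subseteq> {a \<in> A. \<forall>j. D j a \<in> A}"
        using RA D_constant[OF D] EXP_D(4)[OF D] is_subringD(1)[OF \<open>is_subring A\<close>]
        by (auto, metis not_gr_zero UNIV_I subsetD)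
      fix i assume i: "i \<in> {1..Suc m}"
      have "X i \<in> A" unfolding A_def by (rule subalgebra_variable[OF R i])
      moreover have "D j (X i) \<in> A" if "j > 0" for j
        using subsetD[OF subalgebra_mono[OF R, of "i - 1" "Suc m" X] DX[of i j]] that i
        by (auto simp: A_def n)
      ultimately show "X i \<in> {a \<in> A. \<forall>j. D j a \<in> A}"
        using EXP_D(4)[OF D, of "X i"] by (auto, metis not_gr_zero)
    qed
    then show ?thesis using that by (auto simp: A_def)
  qed
  show ?thesis
  proof (cases "B \<subseteq> A")
    case False
    then obtain b where b: "b \<in> B" "b \<notin> A" by blast
    (* The shift of the last variable commutes with D, so it restricts to B. *)
    let ?E = "shift_map A (X n)"
    note E = shift_map_EXP[OF U]
    have comm: "D j (?E l c) = ?E l (D j c)" for j l c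
      using shift_map_commutes[OF D U stable] DX[of n] by (simp add: n A_def)
    have "?E l 0 = 0" for l
      using EXP_D(2)[OF E, of 0 0 l] by (metis UNIV_I add_0_left add_cancel_right_right)
    then have "?E l c \<in> B" if "c \<in> B" for l c
      using that by (auto simp: B_def invariants_iff[OF D] comm)
    then have "?E \<in> EXP k B"
      using kR RA by (intro EXP_restrict[OF E]) auto
    moreover obtain l where "l > 0" "?E l b \<noteq> 0" using shift_map_moves[OF U UNIV_I b(2)] by blast
    ultimately show ?thesis using b not_rigidI unfolding B_def by blast
  next
    case True
    (* Otherwise the first moved variable would be a local slice in A. *)
    have fixed: "exp_hom D (X i) = [:X i:]" if "i \<in> {1..Suc m}" for i
    proof (rule ccontr)
      let ?moved = "\<lambda>i. i \<in> {1..Suc m} \<and> exp_hom D (X i) \<noteq> [:X i:]"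
      assume "exp_hom D (X i) \<noteq> [:X i:]"
      with that have "?moved i" by simp
      then have L: "?moved (Least ?moved)" by (rule LeastI)
      then have "local_slice UNIV D (X (Least ?moved))"
      proof (intro slice ballI)
        fix j assume j: "j \<in> {1..<Least ?moved}"
        then have "\<not> ?moved j" by (intro not_less_Least) simp
        moreover have "j \<in> {1..Suc m}" using j conjunct1[OF L] by simp
        ultimately show "exp_hom D (X j) = [:X j:]" by blast
      qed (use L in \<open>simp_all add: n\<close>)
      moreover have "X (Least ?moved) \<in> A"
        using L subalgebra_variable[OF R] by (simp add: A_def)
      ultimately show False using invariants_not_in_base[OF D U] True by (auto simp: B_def)
    qed
    have "A \<subseteq> B"
      unfolding A_def B_def
      by (intro subalgebra_least invariants_subring[OF D] constants_invariant[OF D])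
         (simp add: fixed invariants_def)
    with True have BA: "B = A" by auto
    (* B is itself a polynomial ring, in which the preceding variable can be shifted since n \<ge> 2. *)
    let ?E = "shift_map (subalgebra R X m) (X (Suc m))"
    note E = shift_map_EXP[OF U']
    have "?E \<in> EXP k B"
      unfolding BA using kR subalgebra_base[OF R, of X m] EXP_D(1)[OF E]
      by (intro EXP_restrict[OF E]) auto
    moreover have "X (Suc m) \<in> B" using univariate_overD(4)[OF U'] BA by simp
    moreover have "?E 1 (X (Suc m)) \<noteq> 0" by (simp add: shift_map_variable[OF U'])
    ultimately show ?thesis using not_rigidI[of ?E k B "X (Suc m)" 1] by (simp add: B_def)
  qed
qed

end
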